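(* Let $G$ be an $n$-vertex graph given as a stream in the Adjacency List (AL) model, and suppose a vertex cover $X$ of $G$ with $|X| = k$ is given. Then \textsc{Diameter} and \textsc{Connectivity} on $G$ can each be solved by a streaming algorithm using $O(2^k k)$ passes and $O(k \log n)$ bits of memory, and can also each be solved by a streaming algorithm using one pass and $O(2^k + k\log n)$ bits of memory.
   Context: Graphs are finite, simple, undirected and unweighted. A vertex cover of $G$ is a set $X \subseteq V(G)$ containing at least one endpoint of every edge. \textsc{Diameter} asks to compute $\max_{s,t \in V(G)} d(s,t)$, where $d(s,t)$ is the shortest-path distance ($+\infty$ if $s,t$ lie in different components); \textsc{Connectivity} asks whether $G$ is connected. In the Adjacency List (AL) streaming model the graph is presented as a sequence of vertices in an arbitrary but fixed order, each vertex appearing together with the complete list of its incident edges (so every edge appears twice, once at each endpoint). A $p$-pass streaming algorithm reads this same sequence $p$ times, has unlimited computation time, and its memory is the number of bits it stores. *)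

theory Defs
  imports Complex_Main "HOL-Library.Extended_Nat"
begin

definition simple_graph :: "'a set \<Rightarrow> 'a set set \<Rightarrow> bool" where
  "simple_graph V E \<longleftrightarrow> finite V \<and> (\<forall>e\<in>E. e \<subseteq> V \<and> card e = 2)"

definition vertex_cover :: "'a set \<Rightarrow> 'a set set \<Rightarrow> 'a set \<Rightarrow> bool" where
  "vertex_cover V E X \<longleftrightarrow> X \<subseteq> V \<and> (\<forall>e\<in>E. e \<inter> X \<noteq> {})"

definition path_between :: "'a set \<Rightarrow> 'a set set \<Rightarrow> 'a \<Rightarrow> 'a \<Rightarrow> 'a list \<Rightarrow> bool" where
  "path_between V E s t p \<longleftrightarrow> p \<noteq> [] \<and> hd p = s \<and> last p = t \<and> set p \<subseteq> V \<and> distinct p \<and>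
     successively (\<lambda>u v. {u, v} \<in> E) p"

text \<open>The infimum of the empty set in \<^typ>\<open>enat\<close> is \<open>\<infinity>\<close>, which is the distance between
  vertices of different components.\<close>

definition graph_dist :: "'a set \<Rightarrow> 'a set set \<Rightarrow> 'a \<Rightarrow> 'a \<Rightarrow> enat" where
  "graph_dist V E s t = (INF p\<in>{p. path_between V E s t p}. enat (length p - 1))"

definition diameter :: "'a set \<Rightarrow> 'a set set \<Rightarrow> enat" where
  "diameter V E = Max {graph_dist V E s t | s t. s \<in> V \<and> t \<in> V}"

definition connected_graph :: "'a set \<Rightarrow> 'a set set \<Rightarrow> bool" where
  "connected_graph V E \<longleftrightarrow> (\<forall>s\<in>V. \<forall>t\<in>V. \<exists>p. path_between V E s t p)"

text \<open>An adjacency list is not read in one step: the vertex and then each of its incident edges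
  arrive as separate tokens, so that the memory bound also applies while a list is being read.
  The end of every pass is visible to the algorithm.\<close>

datatype token = Vertex nat | Edge nat nat | End_Of_Pass

definition al_stream :: "nat set \<Rightarrow> nat set set \<Rightarrow> token list \<Rightarrow> bool" where
  "al_stream V E \<sigma> \<longleftrightarrow> (\<exists>vs nbrs.
     distinct vs \<and> set vs = V \<and>
     (\<forall>v\<in>V. distinct (nbrs v) \<and> set (nbrs v) = {w. {v, w} \<in> E}) \<and>
     \<sigma> = concat (map (\<lambda>v. Vertex v # map (Edge v) (nbrs v)) vs))"

text \<open>The memory is a bit string. Computation time is unlimited, so the transition and output
  functions are arbitrary. The given vertex cover is available only through the initial memory
  content, and a multi-pass algorithm has to keep track of the current pass in its memory.\<close>

record 'r streaming_algorithm =
  init :: "nat set \<Rightarrow> bool list"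
  step :: "token \<Rightarrow> bool list \<Rightarrow> bool list"
  answer :: "bool list \<Rightarrow> 'r"

definition passes :: "nat \<Rightarrow> token list \<Rightarrow> token list" where
  "passes p \<sigma> = concat (replicate p (\<sigma> @ [End_Of_Pass]))"

definition memory_after :: "'r streaming_algorithm \<Rightarrow> nat set \<Rightarrow> token list \<Rightarrow> bool list" where
  "memory_after A X \<tau> = fold (step A) \<tau> (init A X)"

text \<open>\<open>solves A P p b n k\<close>: with \<open>p\<close> passes and at most \<open>b\<close> bits of memory at any time, \<open>A\<close>
  computes \<open>P\<close> on all graphs with vertex set \<open>{..<n}\<close>, given any vertex cover of size \<open>k\<close>.\<close>

definition solves ::
    "'r streaming_algorithm \<Rightarrow> (nat set \<Rightarrow> nat set set \<Rightarrow> 'r) \<Rightarrow> nat \<Rightarrow> nat \<Rightarrow> nat \<Rightarrow> nat \<Rightarrow> bool" where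
  "solves A P p b n k \<longleftrightarrow> (\<forall>E X \<sigma>.
     simple_graph {..<n} E \<longrightarrow> vertex_cover {..<n} E X \<longrightarrow> card X = k \<longrightarrow> al_stream {..<n} E \<sigma> \<longrightarrow>
       answer A (memory_after A X (passes p \<sigma>)) = P {..<n} E \<and>
       (\<forall>j. length (memory_after A X (take j (passes p \<sigma>))) \<le> b))"

text \<open>The algorithm may depend on \<open>n\<close> and \<open>k\<close>, but on neither the graph nor the vertex cover; the
  constant hidden in the \<open>O\<close>-notation is uniform in \<open>n\<close> and \<open>k\<close>.\<close>

definition multi_pass_solvable ::
    "(nat set \<Rightarrow> nat set set \<Rightarrow> 'r) \<Rightarrow> (nat \<Rightarrow> nat \<Rightarrow> real) \<Rightarrow> (nat \<Rightarrow> nat \<Rightarrow> real) \<Rightarrow> bool" where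
  "multi_pass_solvable P f g \<longleftrightarrow>
     (\<exists>(A :: nat \<Rightarrow> nat \<Rightarrow> 'r streaming_algorithm) p b C. \<forall>n\<ge>1. \<forall>k.
        solves (A n k) P (p n k) (b n k) n k \<and>
        real (p n k) \<le> C * f n k \<and> real (b n k) \<le> C * g n k)"

definition one_pass_solvable ::
    "(nat set \<Rightarrow> nat set set \<Rightarrow> 'r) \<Rightarrow> (nat \<Rightarrow> nat \<Rightarrow> real) \<Rightarrow> bool" where
  "one_pass_solvable P g \<longleftrightarrow>
     (\<exists>(A :: nat \<Rightarrow> nat \<Rightarrow> 'r streaming_algorithm) b C. \<forall>n\<ge>1. \<forall>k.
        solves (A n k) P 1 (b n k) n k \<and> real (b n k) \<le> C * g n k)"

end

theory Submission
  imports Defs "HOL-Library.Countable_Set" "HOL-Combinatorics.Transposition"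
begin

text \<open>
  A vertex outside the cover \<open>X\<close> is determined up to an automorphism of \<open>G\<close> by its neighbourhood,
  a subset of \<open>X\<close>. More generally, a map between two graphs with the same cover that is the
  identity on \<open>X\<close> and preserves neighbourhoods in \<open>X\<close> is a homomorphism, hence does not increase
  distances. So the diameter only depends on the edges inside \<open>X\<close> and on which of the \<open>2\<^sup>k\<close>
  neighbourhoods occur, and which of them occur at least twice (twins are at positive distance from
  each other): \<open>k\<^sup>2 + 2 \<cdot> 2\<^sup>k\<close> bits, collected in one pass.

  With less memory, one searches breadth-first from one vertex of each neighbourhood that
  occurs and from each vertex of \<open>X\<close>. Since all neighbours of a vertex outside \<open>X\<close> lie in \<open>X\<close>, a
  layer is determined by the vertices of \<open>X\<close> in the two previous layers, at the expense of one pass.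
  Any two consecutive vertices of a path include one of \<open>X\<close>, so finite distances are at most \<open>2k\<close>.

  Finally, \<open>G\<close> is connected iff its diameter is finite.
\<close>

section \<open>Distances\<close>

text \<open>The vertices at distance less than \<open>i\<close> from \<open>s\<close>; the strict bound makes the recursion
  start at the empty set.\<close>

primrec near :: "'a set set \<Rightarrow> 'a \<Rightarrow> nat \<Rightarrow> 'a set" where
  "near E s 0 = {}"
| "near E s (Suc i) = insert s {w. \<exists>u\<in>near E s i. {u, w} \<in> E}"

lemma path_imp_near:
  assumes "successively (\<lambda>u v. {u, v} \<in> E) p" "p \<noteq> []"
  shows "last p \<in> near E (hd p) (length p)"
  using assms
proof (induction p rule: rev_induct)
  case (snoc x p)
  show ?case
  proof (cases "p = []")
    case False
    with snoc have "last p \<in> near E (hd p) (length p)" "{last p, x} \<in> E"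
      by (auto simp: successively_append_iff)
    with False show ?thesis by auto
  qed simp
qed simp

lemma near_mono: "i \<le> j \<Longrightarrow> near E s i \<subseteq> near E s j"
proof (induction i arbitrary: j)
  case (Suc i)
  then obtain j' where "j = Suc j'" "i \<le> j'" by (cases j) auto
  with Suc.IH[of j'] show ?case by auto
qed simp

text \<open>\<open>near\<close> only sees walks, whereas \<open>path_between\<close> demands
  distinct vertices. If the new endpoint already lies on the path, the prefix ending there is used
  instead.\<close>

lemma near_imp_path:
  assumes "simple_graph V E" "s \<in> V" "t \<in> near E s i"
  shows "\<exists>p. path_between V E s t p \<and> length p \<le> i"
  using assms(3)
proof (induction i arbitrary: t)
  case (Suc i)
  show ?case
  proof (cases "t = s")
    case True
    then have "path_between V E s t [s]" using assms(2) by (auto simp: path_between_def)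
    then show ?thesis by (intro exI[of _ "[s]"]) auto
  next
    case False
    with Suc.prems obtain u where u: "u \<in> near E s i" "{u, t} \<in> E" by auto
    then obtain p where p: "path_between V E s u p" "length p \<le> i" using Suc.IH by blast
    have t: "t \<in> V" using u(2) assms(1) by (auto simp: simple_graph_def)
    show ?thesis
    proof (cases "t \<in> set p")
      case True
      then obtain xs ys where xy: "p = xs @ t # ys" by (meson split_list)
      have "path_between V E s t (xs @ [t])"
        using p(1) unfolding path_between_def xy
        by (auto simp: successively_append_iff hd_append split: if_splits)
      then show ?thesis using p(2) xy by (intro exI[of _ "xs @ [t]"]) auto
    next
      case False
      then have "path_between V E s t (p @ [t])"
        using p(1) t u(2) by (auto simp: path_between_def successively_append_iff)
      then show ?thesis using p(2) by (intro exI[of _ "p @ [t]"]) auto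
    qed
  qed
qed simp

text \<open>The infimum is attained: if every path had more than \<open>Suc D\<close> vertices,
  \<open>enat (Suc D)\<close> would be a lower bound. Lists count vertices, distances count
  edges.\<close>

lemma graph_dist_le_iff_path:
  "graph_dist V E s t \<le> enat D \<longleftrightarrow> (\<exists>p. path_between V E s t p \<and> length p \<le> Suc D)"
proof
  assume *: "graph_dist V E s t \<le> enat D"
  show "\<exists>p. path_between V E s t p \<and> length p \<le> Suc D"
  proof (rule ccontr)
    assume "\<not> ?thesis"
    then have "enat (Suc D) \<le> graph_dist V E s t"
      unfolding graph_dist_def by (intro INF_greatest) (force simp: not_le)
    then have "enat (Suc D) \<le> enat D" using * by (rule order_trans)
    then show False by simp
  qed
next
  assume "\<exists>p. path_between V E s t p \<and> length p \<le> Suc D"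
  then obtain p where p: "path_between V E s t p" "length p \<le> Suc D" by blast
  have "graph_dist V E s t \<le> enat (length p - 1)"
    unfolding graph_dist_def using p(1) by (intro INF_lower) auto
  also have "\<dots> \<le> enat D" using p(2) by auto
  finally show "graph_dist V E s t \<le> enat D" .
qed

lemma graph_dist_le_iff:
  assumes "simple_graph V E" "s \<in> V"
  shows "graph_dist V E s t \<le> enat D \<longleftrightarrow> t \<in> near E s (Suc D)"
proof
  assume "graph_dist V E s t \<le> enat D"
  then obtain p where p: "path_between V E s t p" "length p \<le> Suc D"
    unfolding graph_dist_le_iff_path by blast
  then have "t \<in> near E s (length p)"
    using path_imp_near[of E p] by (auto simp: path_between_def)
  then show "t \<in> near E s (Suc D)" using near_mono[OF p(2), of E s] by blast
next
  assume "t \<in> near E s (Suc D)"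
  then show "graph_dist V E s t \<le> enat D"
    unfolding graph_dist_le_iff_path by (rule near_imp_path[OF assms])
qed

definition all_near :: "'a set \<Rightarrow> 'a set set \<Rightarrow> nat \<Rightarrow> bool" where
  "all_near V E i \<longleftrightarrow> (\<forall>s\<in>V. \<forall>t\<in>V. t \<in> near E s i)"

lemma diameter_le_iff_dist:
  assumes "finite V" "V \<noteq> {}"
  shows "diameter V E \<le> D \<longleftrightarrow> (\<forall>s\<in>V. \<forall>t\<in>V. graph_dist V E s t \<le> D)"
proof -
  have eq: "{graph_dist V E s t | s t. s \<in> V \<and> t \<in> V} = (\<lambda>(s, t). graph_dist V E s t) ` (V \<times> V)"
    by auto
  show ?thesis
    unfolding diameter_def eq using assms by (subst Max_le_iff) auto
qed

lemma diameter_le_iff: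
  assumes "simple_graph V E" "V \<noteq> {}"
  shows "diameter V E \<le> enat D \<longleftrightarrow> all_near V E (Suc D)"
proof -
  have "finite V" using assms(1) by (simp add: simple_graph_def)
  then show ?thesis
    using assms by (simp add: diameter_le_iff_dist graph_dist_le_iff all_near_def del: near.simps)
qed

lemma enat_eqI: "(\<And>D. x \<le> enat D \<longleftrightarrow> y \<le> enat D) \<Longrightarrow> x = y"
  by (metis enat_ord_code(3) not_infinity_eq order_antisym order_refl)

text \<open>The maximum of a finite nonempty set is one of its members, so an infinite diameter is
  witnessed by a pair of vertices that no path joins.\<close>

lemma connected_iff_diameter:
  assumes "finite V" "V \<noteq> {}"
  shows "connected_graph V E \<longleftrightarrow> diameter V E \<noteq> \<infinity>"
proof -
  have conn: "(\<exists>p. path_between V E s t p) \<longleftrightarrow> graph_dist V E s t \<noteq> \<infinity>" for s t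
  proof
    assume "\<exists>p. path_between V E s t p"
    then obtain p where "path_between V E s t p" by blast
    then have "graph_dist V E s t \<le> enat (length p)"
      unfolding graph_dist_le_iff_path by (intro exI[of _ p]) auto
    then show "graph_dist V E s t \<noteq> \<infinity>" by (cases "graph_dist V E s t") auto
  next
    assume "graph_dist V E s t \<noteq> \<infinity>"
    then obtain d where "graph_dist V E s t = enat d" by auto
    then have "graph_dist V E s t \<le> enat d" by simp
    then show "\<exists>p. path_between V E s t p" unfolding graph_dist_le_iff_path by blast
  qed
  let ?S = "{graph_dist V E s t | s t. s \<in> V \<and> t \<in> V}"
  have eq: "?S = (\<lambda>(s, t). graph_dist V E s t) ` (V \<times> V)" by auto
  have fin: "finite ?S" unfolding eq using assms by auto
  have ne: "?S \<noteq> {}" unfolding eq using assms by auto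
  have "diameter V E = \<infinity> \<longleftrightarrow> \<infinity> \<in> ?S"
  proof
    assume "diameter V E = \<infinity>"
    then show "\<infinity> \<in> ?S" using Max_in[OF fin ne] by (simp add: diameter_def)
  next
    assume "\<infinity> \<in> ?S"
    then have "\<infinity> \<le> Max ?S" by (rule Max_ge[OF fin])
    then show "diameter V E = \<infinity>" by (simp add: diameter_def)
  qed
  also have "\<dots> \<longleftrightarrow> (\<exists>s\<in>V. \<exists>t\<in>V. graph_dist V E s t = \<infinity>)" by force
  finally show ?thesis unfolding connected_graph_def conn by auto
qed

section \<open>Vertex covers\<close>

text \<open>Peeling off two vertices at a time yields disjoint edges, each with its own cover
  vertex; the \<open>+ 1\<close> pays for a possible unpaired last vertex.\<close>

lemma path_length_le_cover:
  assumes "successively (\<lambda>u v. {u, v} \<in> E) p" "distinct p" "\<forall>e\<in>E. e \<inter> X \<noteq> {}" "finite X"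
  shows "length p \<le> 2 * card (set p \<inter> X) + 1"
  using assms(1,2)
proof (induction p rule: induct_list012)
  case (3 x y p)
  have IH: "length p \<le> 2 * card (set p \<inter> X) + 1"
    using "3.IH"(1) "3.prems" by (cases p) auto
  have "{x, y} \<in> E" using "3.prems"(1) by simp
  then have "{x, y} \<inter> X \<noteq> {}" using assms(3) by blast
  moreover have "finite ({x, y} \<inter> X)" by (rule finite_Int) simp
  ultimately have "0 < card ({x, y} \<inter> X)" unfolding card_gt_0_iff by (rule conjI)
  moreover have "card (set (x # y # p) \<inter> X) = card ({x, y} \<inter> X) + card (set p \<inter> X)"
  proof -
    have "set (x # y # p) \<inter> X = ({x, y} \<inter> X) \<union> (set p \<inter> X)" by auto
    then show ?thesis using "3.prems"(2) by (auto intro!: card_Un_disjoint)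
  qed
  ultimately show ?case using IH by simp
qed auto

text \<open>The length bound holds for every path, not just for shortest ones, so it is enough that
  some path joins each pair.\<close>

lemma diameter_le_cover:
  assumes "simple_graph V E" "V \<noteq> {}" "vertex_cover V E X" "diameter V E \<noteq> \<infinity>"
  shows "diameter V E \<le> enat (2 * card X)"
proof -
  have fin: "finite V" using assms(1) by (simp add: simple_graph_def)
  have fX: "finite X" using assms(3) fin by (auto simp: vertex_cover_def intro: finite_subset)
  obtain d where "diameter V E = enat d" using assms(4) by auto
  then have d: "graph_dist V E s t \<le> enat d" if "s \<in> V" "t \<in> V" for s t
    using diameter_le_iff_dist[OF fin assms(2), of E "enat d"] that by auto
  have "graph_dist V E s t \<le> enat (2 * card X)" if st: "s \<in> V" "t \<in> V" for s t
  proof -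
    obtain p where p: "path_between V E s t p"
      using d[OF st] unfolding graph_dist_le_iff_path by blast
    then have "length p \<le> 2 * card (set p \<inter> X) + 1"
      using assms(3) fX by (intro path_length_le_cover[of E]) (auto simp: path_between_def vertex_cover_def)
    also have "\<dots> \<le> Suc (2 * card X)" using card_mono[OF fX, of "set p \<inter> X"] by simp
    finally show ?thesis unfolding graph_dist_le_iff_path using p by blast
  qed
  then show ?thesis by (simp add: diameter_le_iff_dist[OF fin assms(2)])
qed

section \<open>Neighbourhood classes and the maps that preserve them\<close>

definition cover_nbrs :: "'a set set \<Rightarrow> 'a set \<Rightarrow> 'a \<Rightarrow> 'a set" where
  "cover_nbrs E X v = {w \<in> X. {v, w} \<in> E}"

text \<open>Vertices outside the cover are classified by their neighbourhood, which lies in the cover;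
  each vertex of the cover forms a class of its own.\<close>

definition kind :: "'a set \<Rightarrow> 'a \<Rightarrow> 'a set \<Rightarrow> 'a set + 'a" where
  "kind X v N = (if v \<in> X then Inr v else Inl N)"

abbreviation kind_of :: "'a set set \<Rightarrow> 'a set \<Rightarrow> 'a \<Rightarrow> 'a set + 'a" where
  "kind_of E X v \<equiv> kind X v (cover_nbrs E X v)"

lemma near_hom:
  assumes "\<And>u v. {u, v} \<in> E \<Longrightarrow> {\<phi> u, \<phi> v} \<in> E'" "v \<in> near E s i"
  shows "\<phi> v \<in> near E' (\<phi> s) i"
  using assms(2) by (induction i arbitrary: v) (auto dest: assms(1))

text \<open>Every edge has an endpoint \<open>x\<close> in the cover, and \<open>\<phi>\<close>
  fixes \<open>x\<close> because \<open>Inr x\<close> is the kind of \<open>x\<close> alone. Whether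
  \<open>x\<close> is adjacent to the image of the other endpoint is then read off the edges inside
  \<open>X\<close> or the neighbourhood of that image.\<close>

lemma kind_preserving_edge:
  assumes G: "simple_graph V E" "vertex_cover V E X"
    and eq: "\<And>x y. x \<in> X \<Longrightarrow> y \<in> X \<Longrightarrow> {x, y} \<in> E \<longleftrightarrow> {x, y} \<in> E'"
    and \<phi>: "\<And>v. v \<in> V \<Longrightarrow> kind_of E' X (\<phi> v) = kind_of E X v"
    and e: "{u, v} \<in> E"
  shows "{\<phi> u, \<phi> v} \<in> E'"
proof -
  have fixed: "\<phi> x = x" if "x \<in> X" for x
    using \<phi>[of x] that G(2) by (auto simp: kind_def vertex_cover_def split: if_splits)
  have *: "{\<phi> x, \<phi> w} \<in> E'" if "x \<in> X" "w \<in> V" "{x, w} \<in> E" for x w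
  proof (cases "w \<in> X")
    case True
    then show ?thesis using that eq fixed by auto
  next
    case False
    with \<phi>[OF that(2)] have "cover_nbrs E' X (\<phi> w) = cover_nbrs E X w"
      by (auto simp: kind_def split: if_splits)
    moreover have "x \<in> cover_nbrs E X w" using that by (auto simp: cover_nbrs_def insert_commute)
    ultimately have "{\<phi> w, x} \<in> E'" unfolding cover_nbrs_def by blast
    then show ?thesis using fixed[OF that(1)] by (simp add: insert_commute)
  qed
  have "u \<in> V" "v \<in> V" using e G(1) by (auto simp: simple_graph_def)
  moreover have "u \<in> X \<or> v \<in> X" using e G(2) by (force simp: vertex_cover_def)
  ultimately show ?thesis using *[of u v] *[of v u] e by (auto simp: insert_commute)
qed

text \<open>Swapping two vertices of the same kind is an automorphism. Hence a search from a single
  source of each kind is enough.\<close>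

lemma near_twin:
  assumes G: "simple_graph V E" "vertex_cover V E X" and "s \<in> V" "s' \<in> V"
    and k: "kind_of E X s = kind_of E X s'" and t: "transpose s s' t \<in> near E s' i"
  shows "t \<in> near E s i"
proof -
  have "kind_of E X (transpose s s' v) = kind_of E X v" for v
    using k by (auto simp: transpose_def)
  then have "{transpose s s' u, transpose s s' v} \<in> E" if "{u, v} \<in> E" for u v
    by (rule kind_preserving_edge[OF G refl _ that])
  from near_hom[OF this t] have "transpose s s' (transpose s s' t) \<in> near E (transpose s s' s') i" .
  then show ?thesis by simp
qed

text \<open>A given pair \<open>s\<close>, \<open>t\<close> is lifted to a pair in the graph
  \<open>E'\<close>, and a homomorphism back to \<open>E\<close> that sends the lifted pair to
  \<open>s\<close>, \<open>t\<close> carries the distance bound over. It need not be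
  injective.\<close>

lemma all_near_transfer:
  assumes G: "simple_graph V E" "vertex_cover V E X"
    and G': "simple_graph V E'" "vertex_cover V E' X"
    and eq: "\<And>x y. x \<in> X \<Longrightarrow> y \<in> X \<Longrightarrow> {x, y} \<in> E \<longleftrightarrow> {x, y} \<in> E'"
    and one: "kind_of E X ` (V - X) = kind_of E' X ` (V - X)"
    and two: "\<And>s t. s \<in> V - X \<Longrightarrow> t \<in> V - X \<Longrightarrow> s \<noteq> t \<Longrightarrow> kind_of E X s = kind_of E X t \<Longrightarrow>
      \<exists>s'\<in>V - X. \<exists>t'\<in>V - X. s' \<noteq> t' \<and> kind_of E' X s' = kind_of E X s \<and> kind_of E' X t' = kind_of E X s"
    and near: "all_near V E' i"
  shows "all_near V E i"
  unfolding all_near_def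
proof (intro ballI)
  fix s t assume st: "s \<in> V" "t \<in> V"
  have ex': "\<exists>v'\<in>V. kind_of E' X v' = kind_of E X v" if "v \<in> V" for v
  proof (cases "v \<in> X")
    case True
    then show ?thesis using that by (auto simp: kind_def)
  next
    case False
    then have "kind_of E X v \<in> kind_of E' X ` (V - X)" using that one by blast
    then show ?thesis by fastforce
  qed
  have ex: "\<exists>v\<in>V. kind_of E X v = kind_of E' X v'" if "v' \<in> V" for v'
  proof (cases "v' \<in> X")
    case True
    then show ?thesis using that by (auto simp: kind_def)
  next
    case False
    then have "kind_of E' X v' \<in> kind_of E X ` (V - X)" using that one by blast
    then show ?thesis by fastforce
  qed
  have "\<exists>s'\<in>V. \<exists>t'\<in>V. kind_of E' X s' = kind_of E X s \<and> kind_of E' X t' = kind_of E X t \<and>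
      (s' = t' \<longleftrightarrow> s = t)"
  \<comment> \<open>Twins are the only pairs whose lifts could collapse to a single vertex;
    assumption \<open>two\<close> supplies distinct ones. Otherwise \<open>s = t\<close>, or
    different kinds force different lifts.\<close>
  proof (cases "s \<noteq> t \<and> kind_of E X s = kind_of E X t")
    case True
    then have "s \<notin> X" "t \<notin> X" by (auto simp: kind_def split: if_splits)
    with two[of s t] st True show ?thesis by auto
  next
    case False
    obtain s' t' where "s' \<in> V" "t' \<in> V" "kind_of E' X s' = kind_of E X s"
      "kind_of E' X t' = kind_of E X t" using ex' st by metis
    with False show ?thesis by (cases "s = t") metis+
  qed
  then obtain s' t' where s't': "s' \<in> V" "t' \<in> V" "kind_of E' X s' = kind_of E X s"
    "kind_of E' X t' = kind_of E X t" "s' = t' \<longleftrightarrow> s = t" by blast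
  \<comment> \<open>The values at \<open>s'\<close> and \<open>t'\<close> are prescribed,
    consistently since \<open>s' = t'\<close> iff \<open>s = t\<close>; elsewhere any vertex of the
    right kind will do.\<close>
  define \<phi> where "\<phi> v = (if v = s' then s else if v = t' then t
    else SOME w. w \<in> V \<and> kind_of E X w = kind_of E' X v)" for v
  have "kind_of E X (\<phi> v) = kind_of E' X v" if "v \<in> V" for v
  proof -
    have "\<exists>w. w \<in> V \<and> kind_of E X w = kind_of E' X v" using ex[OF that] by blast
    from someI_ex[OF this] show ?thesis using s't' by (auto simp: \<phi>_def)
  qed
  then have "{\<phi> u, \<phi> v} \<in> E" if "{u, v} \<in> E'" for u v
    using eq by (intro kind_preserving_edge[OF G' _ _ that]) auto
  moreover have "t' \<in> near E' s' i" using near s't' by (auto simp: all_near_def)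
  ultimately have "\<phi> t' \<in> near E (\<phi> s') i" by (rule near_hom)
  then show "t \<in> near E s i" using s't'(5) by (auto simp: \<phi>_def split: if_splits)
qed

section \<open>From vertex-wise processing to bit strings\<close>

text \<open>Transition functions are arbitrary, so memory is a matter of counting states: any
  injection into the strings of length \<open>b\<close> serves as an encoding.\<close>

lemma ex_bit_encoding:
  assumes "finite S" "card S \<le> 2 ^ b"
  shows "\<exists>(enc :: 's \<Rightarrow> bool list) dec. \<forall>x\<in>S. dec (enc x) = x \<and> length (enc x) = b"
proof -
  let ?B = "{xs :: bool list. set xs \<subseteq> UNIV \<and> length xs = b}"
  have "finite ?B" by (rule finite_lists_length_eq) simp
  moreover have "card S \<le> card ?B" using assms(2) by (subst card_lists_length_eq) simp_all
  ultimately obtain enc where "inj_on enc S" "enc ` S \<subseteq> ?B"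
    using assms(1) by (meson card_le_inj)
  then show ?thesis by (intro exI[of _ enc] exI[of _ "the_inv_into S enc"]) (auto simp: the_inv_into_f_f)
qed

text \<open>Outside of the cover and of the data proper, the memory only holds the vertex that is
  currently read, with its neighbours in the cover seen so far; the vertex is processed as soon
  as its list is complete.\<close>

definition finish :: "(nat \<Rightarrow> nat set \<Rightarrow> 's \<Rightarrow> 's) \<Rightarrow> (nat \<times> nat set) option \<Rightarrow> 's \<Rightarrow> 's" where
  "finish upd c s = (case c of None \<Rightarrow> s | Some (v, N) \<Rightarrow> upd v N s)"

text \<open>A list is known to be complete only when the next \<open>Vertex\<close> token arrives;
  the last list of a pass is completed by \<open>End_Of_Pass\<close>.\<close>

fun token_step :: "(nat set \<Rightarrow> nat \<Rightarrow> nat set \<Rightarrow> 's \<Rightarrow> 's) \<Rightarrow> (nat set \<Rightarrow> 's \<Rightarrow> 's) \<Rightarrow> token \<Rightarrow>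
    nat set \<times> (nat \<times> nat set) option \<times> 's \<Rightarrow> nat set \<times> (nat \<times> nat set) option \<times> 's" where
  "token_step upd endp (Vertex v) (X, c, s) = (X, Some (v, {}), finish (upd X) c s)"
| "token_step upd endp (Edge v w) (X, c, s) =
    (X, map_option (map_prod id (\<lambda>N. N \<union> ({w} \<inter> X))) c, s)"
| "token_step upd endp End_Of_Pass (X, c, s) = (X, None, endp X (finish (upd X) c s))"

lemma fold_token_step_list:
  "fold (token_step upd endp) (Vertex v # map (Edge v) ws) (X, c, s) =
    (X, Some (v, set ws \<inter> X), finish (upd X) c s)"
proof -
  have "fold (token_step upd endp) (map (Edge v) ws) (X, Some (v, N), s) =
    (X, Some (v, N \<union> (set ws \<inter> X)), s)" for N s
    by (induction ws arbitrary: N) auto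
  then show ?thesis by simp
qed

text \<open>The pending entry \<open>c\<close> is arbitrary for the sake of the induction: after the
  list of \<open>v\<close> has been read, \<open>v\<close> itself is pending.\<close>

lemma fold_token_step_pass:
  "fold (token_step upd endp)
      (concat (map (\<lambda>v. Vertex v # map (Edge v) (nbrs v)) vs) @ [End_Of_Pass]) (X, c, s) =
    (X, None, endp X (fold (\<lambda>v. upd X v (set (nbrs v) \<inter> X)) vs (finish (upd X) c s)))"
proof (induction vs arbitrary: c s)
  case (Cons v vs)
  have "fold (token_step upd endp)
      (concat (map (\<lambda>v. Vertex v # map (Edge v) (nbrs v)) (v # vs)) @ [End_Of_Pass]) (X, c, s) =
    fold (token_step upd endp)
      (concat (map (\<lambda>v. Vertex v # map (Edge v) (nbrs v)) vs) @ [End_Of_Pass])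
      (fold (token_step upd endp) (Vertex v # map (Edge v) (nbrs v)) (X, c, s))"
    by simp
  also have "\<dots> = (X, None, endp X (fold (\<lambda>v. upd X v (set (nbrs v) \<inter> X)) (v # vs) (finish (upd X) c s)))"
    unfolding fold_token_step_list Cons.IH by (simp add: finish_def)
  finally show ?case .
qed simp

definition run_pass :: "(nat set \<Rightarrow> nat \<Rightarrow> nat set \<Rightarrow> 's \<Rightarrow> 's) \<Rightarrow> (nat set \<Rightarrow> 's \<Rightarrow> 's) \<Rightarrow>
    nat set set \<Rightarrow> nat set \<Rightarrow> nat list \<Rightarrow> 's \<Rightarrow> 's" where
  "run_pass upd endp E X vs s = endp X (fold (\<lambda>v. upd X v (cover_nbrs E X v)) vs s)"

lemma fold_token_step_passes:
  assumes "\<And>v. v \<in> set vs \<Longrightarrow> set (nbrs v) = {w. {v, w} \<in> E}"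
    and "\<sigma> = concat (map (\<lambda>v. Vertex v # map (Edge v) (nbrs v)) vs)"
  shows "fold (token_step upd endp) (passes p \<sigma>) (X, None, s) =
    (X, None, (run_pass upd endp E X vs ^^ p) s)"
proof -
  have "fold (\<lambda>v. upd X v (set (nbrs v) \<inter> X)) vs s = fold (\<lambda>v. upd X v (cover_nbrs E X v)) vs s" for s
    using assms(1) by (intro fold_cong) (auto simp: cover_nbrs_def Int_def conj_commute)
  then have pass: "fold (token_step upd endp) (\<sigma> @ [End_Of_Pass]) (X, None, s) =
      (X, None, run_pass upd endp E X vs s)" for s
    unfolding assms(2) fold_token_step_pass by (simp add: run_pass_def finish_def)
  show ?thesis
  proof (induction p arbitrary: s)
    case (Suc p)
    have "passes (Suc p) \<sigma> = (\<sigma> @ [End_Of_Pass]) @ passes p \<sigma>" by (simp add: passes_def)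
    then show ?case
      by (simp only: fold_append[of _ "\<sigma> @ [End_Of_Pass]"] comp_apply pass Suc.IH funpow_Suc_right)
  qed (simp add: passes_def)
qed

text \<open>Reduces streaming to vertex-wise updates. The states are counted by three factors: at
  most \<open>n ^ k\<close> covers, \<open>1 + n * 2 ^ k\<close> pending entries and
  \<open>M\<close> values of the data. The algorithm decodes, applies \<open>token_step\<close> and
  encodes again.\<close>

lemma solves_vertexwise:
  fixes S :: "nat set \<Rightarrow> 's set"
  assumes ini: "\<And>X. ini X \<in> S X"
    and upd: "\<And>X v N s. X \<subseteq> {..<n} \<Longrightarrow> card X = k \<Longrightarrow> v < n \<Longrightarrow> N \<subseteq> X \<Longrightarrow> s \<in> S X \<Longrightarrow> upd X v N s \<in> S X"
    and endp: "\<And>X s. X \<subseteq> {..<n} \<Longrightarrow> card X = k \<Longrightarrow> s \<in> S X \<Longrightarrow> endp X s \<in> S X"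
    and S: "\<And>X. X \<subseteq> {..<n} \<Longrightarrow> card X = k \<Longrightarrow> finite (S X) \<and> card (S X) \<le> M"
    and b: "n ^ k * ((1 + n * 2 ^ k) * M) \<le> 2 ^ b"
    and ans: "\<And>E X vs. simple_graph {..<n} E \<Longrightarrow> vertex_cover {..<n} E X \<Longrightarrow> card X = k \<Longrightarrow>
      distinct vs \<Longrightarrow> set vs = {..<n} \<Longrightarrow>
      ans X ((run_pass upd endp E X vs ^^ p) (ini X)) = P {..<n} E"
  shows "\<exists>A. solves A P p b n k"
proof -
  define XS where "XS = {X. X \<subseteq> {..<n} \<and> card X = k}"
  define CS where "CS X = insert None (Some ` ({..<n} \<times> Pow X))" for X :: "nat set"
  define Q where "Q = (SIGMA X:XS. CS X \<times> S X)"
  have finX: "finite X" if "X \<in> XS" for X using that by (auto simp: XS_def intro: finite_subset)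
  have "card XS = n choose k" unfolding XS_def by (subst n_subsets) auto
  also have "\<dots> \<le> n ^ k"
  proof (cases "k \<le> n")
    case True then show ?thesis by (rule binomial_le_pow)
  qed (simp add: binomial_eq_0)
  finally have cXS: "card XS \<le> n ^ k" .
  have finXS: "finite XS" unfolding XS_def by (rule finite_subset[of _ "Pow {..<n}"]) auto
  have CS: "finite (CS X) \<and> card (CS X) \<le> 1 + n * 2 ^ k" if "X \<in> XS" for X
  proof -
    have "card (Some ` ({..<n} \<times> Pow X)) = n * 2 ^ k"
      using that finX[OF that] by (simp add: card_image card_cartesian_product card_Pow XS_def)
    then show ?thesis
      using finX[OF that] card_insert_le_m1[of "Suc (n * 2 ^ k)" "Some ` ({..<n} \<times> Pow X)" None]
      unfolding CS_def by simp
  qed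
  have finS: "finite (S X)" and cS: "card (S X) \<le> M" if "X \<in> XS" for X
    using S[of X] that by (auto simp: XS_def)
  have "finite Q" unfolding Q_def using finXS CS finS by (intro finite_SigmaI) auto
  moreover have "card Q \<le> 2 ^ b"
  proof -
    have "card Q = (\<Sum>X\<in>XS. card (CS X) * card (S X))"
      unfolding Q_def using finXS CS finS by (subst card_SigmaI) (auto simp: card_cartesian_product)
    also have "\<dots> \<le> of_nat (card XS) * ((1 + n * 2 ^ k) * M)"
      using CS cS by (intro sum_bounded_above mult_mono) auto
    also have "\<dots> \<le> n ^ k * ((1 + n * 2 ^ k) * M)" using cXS by (auto intro!: mult_mono)
    finally show ?thesis using b by simp
  qed
  ultimately have "\<exists>(enc :: _ \<Rightarrow> bool list) dec. \<forall>x\<in>Q. dec (enc x) = x \<and> length (enc x) = b"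
    by (rule ex_bit_encoding)
  then obtain enc :: "_ \<Rightarrow> bool list" and dec
    where "\<forall>x\<in>Q. dec (enc x) = x \<and> length (enc x) = b" by blast
  then have enc: "dec (enc x) = x \<and> length (enc x) = b" if "x \<in> Q" for x
    using that by blast
  define A where "A = \<lparr>init = \<lambda>X. enc (X, None, ini X),
    step = \<lambda>t m. enc (token_step upd endp t (dec m)),
    answer = \<lambda>m. case dec m of (X, c, s) \<Rightarrow> ans X s\<rparr>"
  have fin_upd: "finish (upd X) c s \<in> S X" if "X \<in> XS" "c \<in> CS X" "s \<in> S X" for X c s
    using that upd by (auto simp: finish_def CS_def XS_def)
  \<comment> \<open>Only \<open>Vertex\<close> tokens need a bound, as an \<open>Edge\<close> token
    adds nothing outside \<open>X\<close>.\<close>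
  have closed: "token_step upd endp t q \<in> Q" if "q \<in> Q" "\<forall>v. t = Vertex v \<longrightarrow> v < n" for t q
  proof -
    obtain X c s where q: "q = (X, c, s)" by (cases q)
    have X: "X \<in> XS" "c \<in> CS X" "s \<in> S X" using that(1) by (auto simp: Q_def q)
    show ?thesis
    proof (cases t)
      case (Vertex v)
      then show ?thesis using that(2) X fin_upd[OF X] by (auto simp: Q_def q CS_def)
    next
      case (Edge v w)
      then show ?thesis using X by (auto simp: Q_def q CS_def)
    next
      case End_Of_Pass
      then show ?thesis using X fin_upd[OF X] endp by (auto simp: Q_def q CS_def XS_def)
    qed
  qed
  have run: "fold (token_step upd endp) ts q \<in> Q \<and>
      fold (step A) ts (enc q) = enc (fold (token_step upd endp) ts q)"
    if "q \<in> Q" "\<forall>v. Vertex v \<in> set ts \<longrightarrow> v < n" for ts q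
    using that
  proof (induction ts arbitrary: q)
    case (Cons t ts)
    have "token_step upd endp t q \<in> Q" using Cons.prems by (intro closed) auto
    moreover have "step A t (enc q) = enc (token_step upd endp t q)"
      using enc[OF Cons.prems(1)] by (simp add: A_def)
    ultimately show ?case using Cons.IH Cons.prems(2) by simp
  qed simp
  have "solves A P p b n k"
    unfolding solves_def
  proof (intro allI impI)
    fix E X \<sigma>
    assume G: "simple_graph {..<n} E" "vertex_cover {..<n} E X" "card X = k" and "al_stream {..<n} E \<sigma>"
    then obtain vs nbrs where vs: "distinct vs" "set vs = {..<n}"
      and nbrs: "\<forall>v\<in>{..<n}. distinct (nbrs v) \<and> set (nbrs v) = {w. {v, w} \<in> E}"
      and \<sigma>: "\<sigma> = concat (map (\<lambda>v. Vertex v # map (Edge v) (nbrs v)) vs)"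
      unfolding al_stream_def by blast
    have ok: "\<forall>v. Vertex v \<in> set (passes p \<sigma>) \<longrightarrow> v < n"
      using vs(2) unfolding passes_def \<sigma> by (auto split: if_splits)
    have "X \<in> XS" using G by (auto simp: XS_def vertex_cover_def)
    then have q: "(X, None, ini X) \<in> Q" using ini by (auto simp: Q_def CS_def)
    \<comment> \<open>Stated for any list of tokens of the stream: the full run gives the answer,
      the prefixes give the memory bound at all times.\<close>
    have mem: "fold (token_step upd endp) ts (X, None, ini X) \<in> Q \<and>
        memory_after A X ts = enc (fold (token_step upd endp) ts (X, None, ini X))"
      if "set ts \<subseteq> set (passes p \<sigma>)" for ts
      using run[OF q, of ts] that ok by (auto simp: memory_after_def A_def)
    have "fold (token_step upd endp) (passes p \<sigma>) (X, None, ini X) =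
        (X, None, (run_pass upd endp E X vs ^^ p) (ini X))"
      using nbrs vs(2) by (intro fold_token_step_passes[OF _ \<sigma>]) auto
    with mem[of "passes p \<sigma>"] enc have "dec (memory_after A X (passes p \<sigma>)) =
        (X, None, (run_pass upd endp E X vs ^^ p) (ini X))" by auto
    then have "answer A (memory_after A X (passes p \<sigma>)) = P {..<n} E"
      using ans[OF G vs] by (simp add: A_def)
    moreover have "length (memory_after A X (take j (passes p \<sigma>))) \<le> b" for j
      using mem[of "take j (passes p \<sigma>)"] enc set_take_subset by fastforce
    ultimately show "answer A (memory_after A X (passes p \<sigma>)) = P {..<n} E \<and>
        (\<forall>j. length (memory_after A X (take j (passes p \<sigma>))) \<le> b)" by blast
  qed
  then show ?thesis by blast
qed

text \<open>In these cases \<open>real k * log 2 (real n)\<close> is \<open>0\<close>, so the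
  multi-pass bound leaves not a single bit, and for \<open>k = 0\<close> not even a pass. But there
  are no edges, so the answer is a constant.\<close>

lemma solves_edgeless:
  assumes "n = 1 \<or> k = 0"
  shows "\<exists>A. solves A P p 0 n k"
proof -
  define A where "A = \<lparr>init = \<lambda>_. [], step = \<lambda>_ _. [], answer = \<lambda>_. P {..<n} {}\<rparr>"
  have "E = {}" if "simple_graph {..<n} E" "vertex_cover {..<n} E X" "card X = k" for E X
  proof (rule ccontr)
    assume "E \<noteq> {}"
    then obtain e where e: "e \<in> E" by blast
    then have *: "e \<subseteq> {..<n}" "card e = 2" "e \<inter> X \<noteq> {}"
      using that by (auto simp: simple_graph_def vertex_cover_def)
    have "n \<ge> 2" using card_mono[OF _ *(1)] *(2) by simp
    then have "card X = 0" using assms that by simp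
    moreover have "finite X" using that(2) by (auto simp: vertex_cover_def intro: finite_subset)
    ultimately show False using *(3) by simp
  qed
  moreover have "memory_after A X ts = []" for X ts
  proof -
    have "fold (step A) ts [] = []" by (induction ts) (auto simp: A_def)
    then show ?thesis by (simp add: memory_after_def A_def)
  qed
  ultimately have "solves A P p 0 n k" by (simp add: solves_def) (auto simp: A_def)
  then show ?thesis by blast
qed

lemma solves_connected_if_diameter:
  assumes "solves A diameter p b n k" "n \<ge> 1"
  shows "\<exists>A'. solves A' connected_graph p b n k"
proof -
  define A' where "A' = \<lparr>init = init A, step = step A, answer = \<lambda>m. answer A m \<noteq> \<infinity>\<rparr>"
  have "memory_after A' X ts = memory_after A X ts" for X ts
    by (simp add: memory_after_def A'_def)
  moreover have "connected_graph {..<n} E \<longleftrightarrow> diameter {..<n} E \<noteq> \<infinity>" for E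
    using assms(2) by (intro connected_iff_diameter) (auto simp: lessThan_empty_iff)
  ultimately have "solves A' connected_graph p b n k"
    using assms(1) by (simp add: solves_def) (simp add: A'_def)
  then show ?thesis by blast
qed

section \<open>One pass\<close>

text \<open>The memory holds the edges inside the cover (as ordered pairs), the neighbourhoods of the
  vertices outside the cover, and those neighbourhoods which occur at least twice.\<close>

definition summary_upd :: "nat set \<Rightarrow> nat \<Rightarrow> nat set \<Rightarrow>
    (nat \<times> nat) set \<times> nat set set \<times> nat set set \<Rightarrow> (nat \<times> nat) set \<times> nat set set \<times> nat set set" where
  "summary_upd X v N = (\<lambda>(F, S, R). if v \<in> X then (F \<union> {v} \<times> N, S, R)
     else (F, insert N S, if N \<in> S then insert N R else R))"

definition repeated_values :: "('a \<Rightarrow> 'b) \<Rightarrow> 'a set \<Rightarrow> 'b set" where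
  "repeated_values g A = {T. \<exists>u\<in>A. \<exists>v\<in>A. u \<noteq> v \<and> g u = T \<and> g v = T}"

lemma repeated_values_insert:
  assumes "v \<notin> A"
  shows "repeated_values g (insert v A) =
    (if g v \<in> g ` A then insert (g v) (repeated_values g A) else repeated_values g A)"
proof (cases "g v \<in> g ` A")
  case True
  then obtain x where x: "x \<in> A" "g x = g v" by force
  have "\<exists>u\<in>insert v A. \<exists>w\<in>insert v A. u \<noteq> w \<and> g u = g v \<and> g w = g v"
    using x assms by (intro bexI[of _ v] bexI[of _ x]) auto
  then show ?thesis using True by (auto simp: repeated_values_def)
next
  case False
  then have "g w \<noteq> g v" if "w \<in> A" for w using that by (metis imageI)
  then show ?thesis using False by (auto simp: repeated_values_def)
qed

text \<open>\<open>V\<close> stands for the set of vertices read so far, so that partial passes are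
  described too.\<close>

definition summary :: "nat set \<Rightarrow> nat set set \<Rightarrow> nat set \<Rightarrow>
    (nat \<times> nat) set \<times> nat set set \<times> nat set set" where
  "summary V E X = (SIGMA v:V \<inter> X. cover_nbrs E X v, cover_nbrs E X ` (V - X),
     repeated_values (cover_nbrs E X) (V - X))"

lemma fold_summary_upd:
  "distinct vs \<Longrightarrow> fold (\<lambda>v. summary_upd X v (cover_nbrs E X v)) vs ({}, {}, {}) = summary (set vs) E X"
proof (induction vs rule: rev_induct)
  case (snoc v vs)
  have IH: "fold (\<lambda>v. summary_upd X v (cover_nbrs E X v)) vs ({}, {}, {}) = summary (set vs) E X"
    using snoc.IH snoc.prems by simp
  have v: "v \<notin> set vs - X" using snoc.prems by simp
  show ?case
  proof (cases "v \<in> X")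
    case True
    then show ?thesis using IH by (auto simp: summary_upd_def summary_def)
  next
    case False
    then have "set (vs @ [v]) - X = insert v (set vs - X)" "set (vs @ [v]) \<inter> X = set vs \<inter> X" by auto
    then show ?thesis
      using IH False
      by (simp add: summary_upd_def summary_def repeated_values_insert[OF v] del: set_append)
  qed
qed (simp add: summary_def repeated_values_def)

lemma all_near_if_summary_eq:
  assumes G: "simple_graph V E" "vertex_cover V E X"
    and G': "simple_graph V E'" "vertex_cover V E' X"
    and eq: "summary V E X = summary V E' X" and "all_near V E' i"
  shows "all_near V E i"
proof (rule all_near_transfer[OF G G' _ _ _ assms(6)])
  have F: "(SIGMA v:V \<inter> X. cover_nbrs E X v) = (SIGMA v:V \<inter> X. cover_nbrs E' X v)"
    using eq by (simp add: summary_def)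
  fix x y assume "x \<in> X" "y \<in> X"
  moreover have "X \<subseteq> V" using G(2) by (simp add: vertex_cover_def)
  ultimately have "{x, y} \<in> D \<longleftrightarrow> (x, y) \<in> (SIGMA v:V \<inter> X. cover_nbrs D X v)" for D
    by (auto simp: cover_nbrs_def)
  then show "{x, y} \<in> E \<longleftrightarrow> {x, y} \<in> E'" using F by metis
next
  have "kind_of D X ` (V - X) = Inl ` (cover_nbrs D X ` (V - X))" for D
    unfolding image_image by (intro image_cong) (auto simp: kind_def)
  moreover have "cover_nbrs E X ` (V - X) = cover_nbrs E' X ` (V - X)"
    using eq by (simp add: summary_def)
  ultimately show "kind_of E X ` (V - X) = kind_of E' X ` (V - X)" by simp
next
  have R: "repeated_values (cover_nbrs E X) (V - X) = repeated_values (cover_nbrs E' X) (V - X)"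
    using eq by (simp add: summary_def)
  fix s t assume st: "s \<in> V - X" "t \<in> V - X" "s \<noteq> t" "kind_of E X s = kind_of E X t"
  then have "cover_nbrs E X s = cover_nbrs E X t" by (simp add: kind_def)
  with st have "cover_nbrs E X s \<in> repeated_values (cover_nbrs E X) (V - X)"
    by (auto simp: repeated_values_def)
  then obtain s' t' where "s' \<in> V - X" "t' \<in> V - X" "s' \<noteq> t'"
    "cover_nbrs E' X s' = cover_nbrs E X s" "cover_nbrs E' X t' = cover_nbrs E X s"
    unfolding R by (auto simp: repeated_values_def)
  then show "\<exists>s'\<in>V - X. \<exists>t'\<in>V - X. s' \<noteq> t' \<and> kind_of E' X s' = kind_of E X s \<and>
      kind_of E' X t' = kind_of E X s"
    using st by (intro bexI[of _ s'] bexI[of _ t']) (auto simp: kind_def)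
qed

lemma diameter_eq_if_summary_eq:
  assumes "simple_graph V E" "vertex_cover V E X" "simple_graph V E'" "vertex_cover V E' X"
    and "summary V E X = summary V E' X" and "V \<noteq> {}"
  shows "diameter V E = diameter V E'"
proof (rule enat_eqI)
  fix D
  have "all_near V E (Suc D) \<longleftrightarrow> all_near V E' (Suc D)"
    using all_near_if_summary_eq assms by metis
  then show "diameter V E \<le> enat D \<longleftrightarrow> diameter V E' \<le> enat D"
    using assms by (simp add: diameter_le_iff)
qed

section \<open>Numerical estimates, and the one-pass algorithm\<close>

lemma le_two_power_ceiling:
  assumes "real M \<le> 2 powr x" "x \<ge> 0"
  shows "M \<le> 2 ^ nat \<lceil>x\<rceil>"
proof -
  have "real M \<le> 2 powr real (nat \<lceil>x\<rceil>)"
    using assms by (meson powr_mono real_nat_ceiling_ge order_trans one_le_numeral)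
  then have "real M \<le> real (2 ^ nat \<lceil>x\<rceil>)" by (simp add: powr_realpow)
  then show ?thesis by (simp only: of_nat_le_iff)
qed

lemma power_mult_eq_two_powr:
  assumes "n \<ge> 1"
  shows "real (n ^ a * 2 ^ c) = 2 powr (real a * log 2 (real n) + real c)"
proof -
  have "real n ^ a = (2 powr log 2 (real n)) powr real a" using assms by (simp add: powr_realpow)
  also have "\<dots> = 2 powr (real a * log 2 (real n))" by (simp only: powr_powr mult.commute)
  finally show ?thesis by (simp add: powr_add powr_realpow)
qed

lemma Suc_le_two_power: "Suc k \<le> 2 ^ k"
  by (induction k) auto

lemma square_le_two_power: "k * k \<le> 2 * 2 ^ k" for k :: nat
proof (induction k)
  case (Suc k)
  \<comment> \<open>From \<open>k = 3\<close> on, \<open>2 * k + 1 \<le> k * k\<close>, so the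
    square at most doubles; smaller values are checked directly.\<close>
  have "k = 0 \<or> k = 1 \<or> k = 2 \<or> k \<ge> 3" by linarith
  then show ?case
  proof (elim disjE)
    assume k: "k \<ge> 3"
    then have "3 * k \<le> k * k" by (rule mult_le_mono1)
    moreover have "Suc k * Suc k = k * k + 2 * k + 1" by simp
    ultimately have "Suc k * Suc k \<le> 2 * (k * k)" using k by linarith
    then show ?thesis using Suc by simp
  qed auto
qed simp

text \<open>The answer is the diameter of an arbitrary graph with the stored cover and summary; by
  \<open>diameter_eq_if_summary_eq\<close> all of these agree. \<open>M\<close> counts a set of
  ordered pairs from the cover and two families of subsets of it.\<close>

lemma one_pass_diameter_nontrivial:
  assumes n: "n \<ge> 2" and k: "k \<ge> 1"
  defines "b \<equiv> nat \<lceil>2 * real k * log 2 (real n) + 5 * 2 ^ k\<rceil>"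
  shows "\<exists>A. solves A diameter 1 b n k"
proof (rule solves_vertexwise[where ini = "\<lambda>_. ({}, {}, {})" and upd = summary_upd and endp = "\<lambda>_ s. s"
      and S = "\<lambda>X. Pow (X \<times> X) \<times> Pow (Pow X) \<times> Pow (Pow X)"
      and M = "2 ^ (k * k) * (2 ^ 2 ^ k * 2 ^ 2 ^ k)"
      and ans = "\<lambda>X s. SOME d. \<exists>E. simple_graph {..<n} E \<and> vertex_cover {..<n} E X \<and>
        summary {..<n} E X = s \<and> diameter {..<n} E = d"])
  show "summary_upd X v N s \<in> Pow (X \<times> X) \<times> Pow (Pow X) \<times> Pow (Pow X)"
    if "N \<subseteq> X" "s \<in> Pow (X \<times> X) \<times> Pow (Pow X) \<times> Pow (Pow X)" for X v N s
    using that by (fastforce simp: summary_upd_def)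
  show "finite (Pow (X \<times> X) \<times> Pow (Pow X) \<times> Pow (Pow X)) \<and>
      card (Pow (X \<times> X) \<times> Pow (Pow X) \<times> Pow (Pow X)) \<le> 2 ^ (k * k) * (2 ^ 2 ^ k * 2 ^ 2 ^ k)"
    if "X \<subseteq> {..<n}" "card X = k" for X
    using that finite_subset[of X "{..<n}"] by (simp add: card_cartesian_product card_Pow)
  have log: "log 2 (real n) \<ge> 0" using n by (simp add: zero_le_log_cancel_iff)
  have "n ^ k * ((1 + n * 2 ^ k) * (2 ^ (k * k) * (2 ^ 2 ^ k * 2 ^ 2 ^ k))) \<le>
      n ^ k * ((n ^ k * 2 ^ Suc k) * (2 ^ (k * k) * (2 ^ 2 ^ k * 2 ^ 2 ^ k)))"
  proof -
    have "1 + n * 2 ^ k \<le> n * 2 ^ Suc k" using n by (simp add: Suc_le_eq)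
    also have "\<dots> \<le> n ^ k * 2 ^ Suc k" using n k by (intro mult_le_mono1 self_le_power) auto
    finally show ?thesis by (intro mult_le_mono2 mult_le_mono1)
  qed
  also have "\<dots> = n ^ (2 * k) * 2 ^ (Suc k + k * k + 2 ^ k + 2 ^ k)"
    unfolding mult_2 power_add by (simp only: mult_ac)
  \<comment> \<open>The summands of the exponent are at most \<open>1\<close>, \<open>2\<close>,
    \<open>1\<close> and \<open>1\<close> times \<open>2 ^ k\<close>.\<close>
  also have "\<dots> \<le> n ^ (2 * k) * 2 ^ (5 * 2 ^ k)"
    using Suc_le_two_power[of k] square_le_two_power[of k]
    by (intro mult_le_mono2 power_increasing) auto
  finally have "real (n ^ k * ((1 + n * 2 ^ k) * (2 ^ (k * k) * (2 ^ 2 ^ k * 2 ^ 2 ^ k)))) \<le>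
      real (n ^ (2 * k) * 2 ^ (5 * 2 ^ k))" by (simp only: of_nat_le_iff)
  also have "\<dots> = 2 powr (real (2 * k) * log 2 (real n) + real (5 * 2 ^ k))"
    using n by (intro power_mult_eq_two_powr) simp
  also have "\<dots> = 2 powr (2 * real k * log 2 (real n) + 5 * 2 ^ k)" by simp
  finally show "n ^ k * ((1 + n * 2 ^ k) * (2 ^ (k * k) * (2 ^ 2 ^ k * 2 ^ 2 ^ k))) \<le> 2 ^ b"
    unfolding b_def using log by (intro le_two_power_ceiling) auto
  show "(SOME d. \<exists>E'. simple_graph {..<n} E' \<and> vertex_cover {..<n} E' X \<and>
      summary {..<n} E' X = (run_pass summary_upd (\<lambda>_ s. s) E X vs ^^ 1) ({}, {}, {}) \<and>
      diameter {..<n} E' = d) = diameter {..<n} E"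
    if G: "simple_graph {..<n} E" "vertex_cover {..<n} E X" and vs: "distinct vs" "set vs = {..<n}"
    for E X vs
  proof (rule some_equality)
    have run: "(run_pass summary_upd (\<lambda>_ s. s) E X vs ^^ 1) ({}, {}, {}) = summary {..<n} E X"
      using fold_summary_upd[OF vs(1), of X E] vs(2) by (simp add: run_pass_def)
    show "\<exists>E'. simple_graph {..<n} E' \<and> vertex_cover {..<n} E' X \<and>
        summary {..<n} E' X = (run_pass summary_upd (\<lambda>_ s. s) E X vs ^^ 1) ({}, {}, {}) \<and>
        diameter {..<n} E' = diameter {..<n} E"
      unfolding run using G by blast
    have ne: "{..<n} \<noteq> {}" using n by (auto simp: lessThan_empty_iff)
    show "d = diameter {..<n} E"
      if "\<exists>E'. simple_graph {..<n} E' \<and> vertex_cover {..<n} E' X \<and>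
        summary {..<n} E' X = (run_pass summary_upd (\<lambda>_ s. s) E X vs ^^ 1) ({}, {}, {}) \<and>
        diameter {..<n} E' = d" for d
      using that G diameter_eq_if_summary_eq[OF _ _ _ _ _ ne] unfolding run by blast
  qed
qed simp_all

section \<open>Many passes\<close>

lemma fold_find:
  "fold (\<lambda>v r. if r = None \<and> P v then Some v else r) vs r = (if r = None then find P vs else r)"
  by (induction vs arbitrary: r) auto

text \<open>In round \<open>0\<close> for the \<open>j\<close>-th kind, the first vertex of this kind is selected as the source.
  In round \<open>m \<ge> 1\<close>, \<open>A\<close> and \<open>B\<close> are the vertices of the cover at distance less than
  \<open>m - 1\<close> and less than \<open>m\<close> from the source, which suffices to decide for every vertex when its list
  is complete whether its distance is less than \<open>m\<close>; \<open>C\<close> collects the neighbours of those for which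
  this holds. \<open>W\<close> holds all \<open>m\<close> for which this fails for some source and some vertex.\<close>

type_synonym bfs_state =
  "nat \<times> nat \<times> nat option \<times> nat set \<times> nat set \<times> nat set \<times> nat set"

text \<open>An enumeration of all \<open>2 ^ k + k\<close> conceivable kinds, whether they occur or
  not. It depends on \<open>X\<close> alone, so storing an index suffices.\<close>

definition nth_kind :: "nat set \<Rightarrow> nat \<Rightarrow> nat set + nat" where
  "nth_kind X = from_nat_into (Pow X <+> X)"

definition bfs_upd :: "nat set \<Rightarrow> nat \<Rightarrow> nat set \<Rightarrow> bfs_state \<Rightarrow> bfs_state" where
  "bfs_upd X v N = (\<lambda>(j, m, src, A, B, C, W).
     if m = 0 then (j, m, if src = None \<and> kind X v N = nth_kind X j then Some v else src, A, B, C, W)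
     else case src of None \<Rightarrow> (j, m, src, A, B, C, W)
     | Some s \<Rightarrow>
         if v = s \<or> (if v \<in> X then v \<in> B else N \<inter> A \<noteq> {})
         then (j, m, src, A, B, C \<union> N, W) else (j, m, src, A, B, C, insert m W))"

text \<open>Rounds \<open>0\<close> to \<open>2 * card X + 1\<close> serve one source. The source
  belongs to every layer but need not be in \<open>C\<close>, so it is added here. The cap on
  \<open>j\<close> keeps the state set finite.\<close>

definition bfs_endp :: "nat set \<Rightarrow> bfs_state \<Rightarrow> bfs_state" where
  "bfs_endp X = (\<lambda>(j, m, src, A, B, C, W).
     if m = 2 * card X + 1 then (min (2 ^ card X + card X) (Suc j), 0, None, {}, {}, {}, W)
     else (j, Suc m, src, B, C \<union> (set_option src \<inter> X), {}, W))"

definition bfs_states :: "nat \<Rightarrow> nat set \<Rightarrow> bfs_state set" where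
  "bfs_states n X = {..2 ^ card X + card X} \<times> {..2 * card X + 1} \<times> insert None (Some ` {..<n}) \<times>
     Pow X \<times> Pow X \<times> Pow X \<times> Pow {..2 * card X + 1}"

lemma bfs_upd_closed:
  assumes "v < n" "N \<subseteq> X" "s \<in> bfs_states n X"
  shows "bfs_upd X v N s \<in> bfs_states n X"
  using assms unfolding bfs_states_def bfs_upd_def
  by (cases s) (auto split: option.splits)

lemma bfs_endp_closed:
  assumes "s \<in> bfs_states n X"
  shows "bfs_endp X s \<in> bfs_states n X"
  using assms unfolding bfs_states_def bfs_endp_def by (cases s) auto

lemma card_bfs_states:
  assumes "finite X" "card X = k" "n \<ge> 1"
  shows "finite (bfs_states n X) \<and> card (bfs_states n X) \<le> n * 2 ^ (7 * k + 5)"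
proof
  show "finite (bfs_states n X)" using assms(1) by (simp add: bfs_states_def)
  have "card (insert None (Some ` {..<n})) \<le> Suc n"
    using card_insert_le_m1[of "Suc n" "Some ` {..<n}" None] by (simp add: card_image)
  then have "card (insert None (Some ` {..<n})) \<le> 2 * n" using assms(3) by linarith
  moreover have "Suc (2 ^ k + k) \<le> 2 ^ Suc k" "2 * k + 2 \<le> 2 ^ Suc k"
    using Suc_le_two_power[of k] by simp_all
  \<comment> \<open>The factors bound, in order, \<open>j\<close>, \<open>m\<close>, the source,
    \<open>A\<close>, \<open>B\<close>, \<open>C\<close> and \<open>W\<close>; the exponents of
    \<open>2\<close> add up to \<open>7 * k + 5\<close>.\<close>
  ultimately have "card (bfs_states n X) \<le>
      2 ^ Suc k * (2 ^ Suc k * ((2 * n) * (2 ^ k * (2 ^ k * (2 ^ k * 2 ^ (2 * k + 2))))))"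
    using assms unfolding bfs_states_def
    by (simp only: card_cartesian_product card_Pow card_atMost finite_atMost Suc_eq_plus1 add.assoc
        one_add_one) (intro mult_le_mono, auto)
  also have "\<dots> = n * 2 ^ (Suc k + (Suc k + (1 + (k + (k + (k + (2 * k + 2)))))))"
    unfolding power_add power_one_right by (simp only: mult_ac)
  also have "\<dots> = n * 2 ^ (7 * k + 5)" by (rule arg_cong[where f = "\<lambda>x. n * 2 ^ x"]) simp
  finally show "card (bfs_states n X) \<le> n * 2 ^ (7 * k + 5)" .
qed

section \<open>Correctness of the breadth-first searches\<close>

locale covered_graph =
  fixes n :: nat and E :: "nat set set" and X :: "nat set" and vs :: "nat list"
  assumes graph: "simple_graph {..<n} E" and cover: "vertex_cover {..<n} E X"
    and vs: "set vs = {..<n}"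
begin

lemma cover_subset: "X \<subseteq> {..<n}"
  using cover by (simp add: vertex_cover_def)

lemma finite_cover: "finite X"
  using cover_subset finite_subset by blast

lemma near_outside_cover:
  assumes "v \<notin> X"
  shows "v \<in> near E s (Suc i) \<longleftrightarrow> v = s \<or> cover_nbrs E X v \<inter> (X \<inter> near E s i) \<noteq> {}"
proof -
  have "u \<in> X" if "{u, v} \<in> E" for u
    using that cover assms by (force simp: vertex_cover_def)
  then show ?thesis by (auto simp: cover_nbrs_def insert_commute)
qed

lemma near_subset: "s < n \<Longrightarrow> near E s i \<subseteq> {..<n}"
proof (cases i)
  case (Suc i)
  assume "s < n"
  with Suc graph show ?thesis by (auto simp: simple_graph_def)
qed simp

text \<open>A kind that does not occur has source \<open>None\<close> and excludes no
  radius.\<close>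

definition far :: "nat option \<Rightarrow> nat set" where
  "far src = {m. \<exists>s. src = Some s \<and> (\<exists>v<n. v \<notin> near E s m)}"

definition cover_near :: "nat option \<Rightarrow> nat \<Rightarrow> nat set" where
  "cover_near src i = (case src of None \<Rightarrow> {} | Some s \<Rightarrow> X \<inter> near E s i)"

definition source :: "nat \<Rightarrow> nat option" where
  "source j = find (\<lambda>v. kind_of E X v = nth_kind X j) vs"

lemma source_less: "source j = Some s \<Longrightarrow> s < n"
  using vs by (auto simp: source_def find_Some_iff)

abbreviation bfs_pass :: "bfs_state \<Rightarrow> bfs_state" where
  "bfs_pass \<equiv> run_pass bfs_upd bfs_endp E X vs"

abbreviation round_state :: "nat \<Rightarrow> nat \<Rightarrow> nat option \<Rightarrow> nat set \<Rightarrow> bfs_state" where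
  "round_state j i src W \<equiv> (j, Suc i, src, cover_near src i, cover_near src (Suc i), {}, W)"

lemma bfs_pass_0:
  "bfs_pass (j, 0, None, {}, {}, {}, W) = round_state j 0 (source j) W"
proof -
  have "fold (\<lambda>v. bfs_upd X v (cover_nbrs E X v)) us (j, 0, src, {}, {}, {}, W) =
      (j, 0, fold (\<lambda>v r. if r = None \<and> kind_of E X v = nth_kind X j then Some v else r) us src,
        {}, {}, {}, W)" for us src
    by (induction us arbitrary: src) (auto simp: bfs_upd_def)
  then show ?thesis
    unfolding run_pass_def fold_find
    by (auto simp: bfs_endp_def source_def[symmetric] cover_near_def split: option.splits)
qed

lemma bfs_pass_Suc:
  assumes "\<And>s. src = Some s \<Longrightarrow> s < n"
  shows "bfs_pass (round_state j i src W) =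
    (if i = 2 * card X
     then (min (2 ^ card X + card X) (Suc j), 0, None, {}, {}, {}, W \<union> ({Suc i} \<inter> far src))
     else round_state j (Suc i) src (W \<union> ({Suc i} \<inter> far src)))"
proof (cases src)
  case None
  have "fold (\<lambda>v. bfs_upd X v (cover_nbrs E X v)) us (round_state j i None W) = round_state j i None W" for us
    by (induction us) (auto simp: bfs_upd_def)
  then show ?thesis
    by (auto simp: run_pass_def bfs_endp_def None far_def cover_near_def)
next
  case (Some s)
  let ?A = "X \<inter> near E s i" and ?B = "X \<inter> near E s (Suc i)"
  \<comment> \<open>The test in \<open>bfs_upd\<close> is exact: \<open>B\<close> answers for cover
    vertices, and for the others all possible predecessors lie in \<open>A\<close>.\<close>
  have reach: "v = s \<or> (if v \<in> X then v \<in> ?B else cover_nbrs E X v \<inter> ?A \<noteq> {}) \<longleftrightarrow> v \<in> near E s (Suc i)" for v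
    using near_outside_cover[of v s i] by auto
  have "bfs_upd X v (cover_nbrs E X v) (j, Suc i, Some s, ?A, ?B, C, W) =
      (if v \<in> near E s (Suc i) then (j, Suc i, Some s, ?A, ?B, C \<union> cover_nbrs E X v, W)
       else (j, Suc i, Some s, ?A, ?B, C, insert (Suc i) W))" for v C W
    using reach[of v] by (simp add: bfs_upd_def del: near.simps)
  then have fold: "fold (\<lambda>v. bfs_upd X v (cover_nbrs E X v)) us (j, Suc i, Some s, ?A, ?B, C, W) =
      (j, Suc i, Some s, ?A, ?B, C \<union> \<Union> (cover_nbrs E X ` (set us \<inter> near E s (Suc i))),
        W \<union> {m. m = Suc i \<and> (\<exists>v\<in>set us. v \<notin> near E s (Suc i))})" for us C W
    by (induction us arbitrary: C W) (auto simp del: near.simps)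
  \<comment> \<open>The recursion of \<open>near\<close>, restricted to the cover. Each vertex of
    the layer occurs in the stream, so all its neighbours in \<open>X\<close> get collected.\<close>
  have "\<Union> (cover_nbrs E X ` (set vs \<inter> near E s (Suc i))) \<union> ({s} \<inter> X) = X \<inter> near E s (Suc (Suc i))"
    using near_subset[of s "Suc i"] assms Some unfolding vs near.simps(2)[of E s "Suc i"] cover_nbrs_def
    by (auto simp del: near.simps)
  moreover have "{m. m = Suc i \<and> (\<exists>v\<in>set vs. v \<notin> near E s (Suc i))} = {Suc i} \<inter> far src"
    using vs by (auto simp: far_def Some simp del: near.simps)
  ultimately show ?thesis
    using fold[of vs "{}" W]
    by (simp add: run_pass_def bfs_endp_def Some cover_near_def del: near.simps)
qed

lemma bfs_rounds:
  assumes "\<And>s. src = Some s \<Longrightarrow> s < n" "i \<le> 2 * card X"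
  shows "(bfs_pass ^^ i) (round_state j 0 src W) = round_state j i src (W \<union> ({1..i} \<inter> far src))"
  using assms(2)
proof (induction i)
  case (Suc i)
  have "{1..Suc i} = insert (Suc i) {1..i}" by auto
  then have "W \<union> ({1..i} \<inter> far src) \<union> ({Suc i} \<inter> far src) = W \<union> ({1..Suc i} \<inter> far src)" by auto
  then show ?case using Suc bfs_pass_Suc[OF assms(1), of src j i] by simp
qed simp

lemma bfs_source:
  "(bfs_pass ^^ (2 * card X + 2)) (j, 0, None, {}, {}, {}, W) =
    (min (2 ^ card X + card X) (Suc j), 0, None, {}, {}, {}, W \<union> ({1..2 * card X + 1} \<inter> far (source j)))"
proof -
  have "{1..2 * card X + 1} = insert (Suc (2 * card X)) {1..2 * card X}" by auto
  then have eq: "W \<union> ({1..2 * card X} \<inter> far (source j)) \<union> ({Suc (2 * card X)} \<inter> far (source j)) =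
      W \<union> ({1..2 * card X + 1} \<inter> far (source j))" by auto
  \<comment> \<open>One pass selects the source, \<open>2 * card X\<close> passes advance the
    search, and the last one also resets the state.\<close>
  have "(bfs_pass ^^ (2 * card X + 2)) (j, 0, None, {}, {}, {}, W) =
      bfs_pass ((bfs_pass ^^ (2 * card X)) (bfs_pass (j, 0, None, {}, {}, {}, W)))"
    by (simp add: funpow_swap1)
  also have "\<dots> = bfs_pass (round_state j (2 * card X) (source j) (W \<union> ({1..2 * card X} \<inter> far (source j))))"
    unfolding bfs_pass_0 using source_less by (subst bfs_rounds) auto
  also have "\<dots> = (min (2 ^ card X + card X) (Suc j), 0, None, {}, {}, {},
      W \<union> ({1..2 * card X + 1} \<inter> far (source j)))"
    using source_less eq by (subst bfs_pass_Suc) auto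
  finally show ?thesis .
qed

lemma bfs_sources:
  assumes "a \<le> 2 ^ card X + card X"
  shows "(bfs_pass ^^ (a * (2 * card X + 2))) (0, 0, None, {}, {}, {}, {}) =
    (a, 0, None, {}, {}, {}, {1..2 * card X + 1} \<inter> (\<Union>j<a. far (source j)))"
  using assms
proof (induction a)
  case (Suc a)
  have "(bfs_pass ^^ (Suc a * (2 * card X + 2))) (0, 0, None, {}, {}, {}, {}) =
      (bfs_pass ^^ (2 * card X + 2)) ((bfs_pass ^^ (a * (2 * card X + 2))) (0, 0, None, {}, {}, {}, {}))"
    by (simp only: mult_Suc funpow_add comp_apply)
  also have "\<dots> = (min (2 ^ card X + card X) (Suc a), 0, None, {}, {}, {},
      {1..2 * card X + 1} \<inter> (\<Union>j<a. far (source j)) \<union> ({1..2 * card X + 1} \<inter> far (source a)))"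
    using Suc by (simp only: bfs_source Suc_leD)
  also have "\<dots> = (Suc a, 0, None, {}, {}, {}, {1..2 * card X + 1} \<inter> (\<Union>j<Suc a. far (source j)))"
    using Suc.prems by (simp add: lessThan_Suc Int_Un_distrib Un_commute min_def del: atLeastAtMost_iff)
  finally show ?case .
qed simp

lemma ex_nth_kind:
  assumes "v < n"
  shows "\<exists>j<2 ^ card X + card X. nth_kind X j = kind_of E X v"
proof -
  have fin: "finite (Pow X <+> X)" and card: "card (Pow X <+> X) = 2 ^ card X + card X"
    using finite_cover by (simp_all add: card_Plus card_Pow)
  have "kind_of E X v \<in> Pow X <+> X"
    by (auto simp: kind_def cover_nbrs_def)
  also have "\<dots> = from_nat_into (Pow X <+> X) ` {..<2 ^ card X + card X}"
    using bij_betw_from_nat_into_finite[OF fin] unfolding card by (simp add: bij_betw_def)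
  finally show ?thesis by (auto simp: nth_kind_def)
qed

text \<open>If \<open>t\<close> is too far from \<open>s\<close>, let \<open>s'\<close> be the
  chosen source of the same kind. By \<open>near_twin\<close> the image of \<open>t\<close> under
  the transposition is too far from \<open>s'\<close>.\<close>

lemma far_sources:
  "(\<Union>j<2 ^ card X + card X. far (source j)) = {m. \<not> all_near {..<n} E m}"
proof (intro equalityI subsetI)
  fix m assume "m \<in> (\<Union>j<2 ^ card X + card X. far (source j))"
  then show "m \<in> {m. \<not> all_near {..<n} E m}"
    using source_less by (force simp: far_def all_near_def)
next
  fix m assume "m \<in> {m. \<not> all_near {..<n} E m}"
  then obtain s t where st: "s < n" "t < n" "t \<notin> near E s m" by (auto simp: all_near_def)
  obtain j where j: "j < 2 ^ card X + card X" "nth_kind X j = kind_of E X s"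
    using ex_nth_kind[OF st(1)] by blast
  have "source j \<noteq> None" using st(1) j(2) vs by (auto simp: source_def find_None_iff)
  then obtain s' where s': "source j = Some s'" by blast
  then have "s' < n" by (rule source_less)
  moreover have "kind_of E X s' = kind_of E X s"
    using s' j(2) by (auto simp: source_def find_Some_iff)
  ultimately have "transpose s s' t \<notin> near E s' m"
    using st near_twin[OF graph cover, of s s' t m] by auto
  moreover have "transpose s s' t < n" using st \<open>s' < n\<close> by (simp add: transpose_def)
  ultimately have "m \<in> far (source j)" using s' by (auto simp: far_def)
  with j(1) show "m \<in> (\<Union>j<2 ^ card X + card X. far (source j))" by blast
qed

text \<open>The surviving \<open>m\<close> are those exceeding the diameter, whence
  \<open>m - 1\<close>. A finite diameter is at most \<open>2 * card X\<close>, so it is found in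
  the range; otherwise no \<open>m\<close> survives and the empty infimum is infinite.\<close>

lemma diameter_eq_INF:
  assumes "n \<ge> 1"
  shows "(INF m\<in>{1..2 * card X + 1} - {m. \<not> all_near {..<n} E m}. enat (m - 1)) = diameter {..<n} E"
proof -
  have ne: "{..<n} \<noteq> {}" using assms by (auto simp: lessThan_empty_iff)
  have le: "diameter {..<n} E \<le> enat (m - 1) \<longleftrightarrow> all_near {..<n} E m" if "m \<ge> 1" for m
    using diameter_le_iff[OF graph ne, of "m - 1"] that by simp
  show ?thesis
  proof (rule antisym)
    show "diameter {..<n} E \<le> (INF m\<in>{1..2 * card X + 1} - {m. \<not> all_near {..<n} E m}. enat (m - 1))"
      using le by (intro INF_greatest) auto
    show "(INF m\<in>{1..2 * card X + 1} - {m. \<not> all_near {..<n} E m}. enat (m - 1)) \<le> diameter {..<n} E"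
    proof (cases "diameter {..<n} E")
      case (enat d)
      then have "d \<le> 2 * card X" using diameter_le_cover[OF graph ne cover] by simp
      moreover have "all_near {..<n} E (Suc d)" using le[of "Suc d"] enat by simp
      ultimately have "Suc d \<in> {1..2 * card X + 1} - {m. \<not> all_near {..<n} E m}" by simp
      then have "(INF m\<in>{1..2 * card X + 1} - {m. \<not> all_near {..<n} E m}. enat (m - 1)) \<le> enat (Suc d - 1)"
        by (rule INF_lower)
      then show ?thesis using enat by simp
    qed simp
  qed
qed

end

lemma multi_pass_diameter_nontrivial:
  assumes n: "n \<ge> 2" and k: "k \<ge> 1"
  shows "\<exists>A. solves A diameter ((2 ^ k + k) * (2 * k + 2)) (nat \<lceil>17 * real k * log 2 (real n)\<rceil>) n k"
proof (rule solves_vertexwise[where ini = "\<lambda>_. (0, 0, None, {}, {}, {}, {})" and upd = bfs_upd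
      and endp = bfs_endp and S = "bfs_states n" and M = "n * 2 ^ (7 * k + 5)"
      and ans = "\<lambda>X (j, m, src, A, B, C, W). INF m\<in>{1..2 * card X + 1} - W. enat (m - 1)"])
  show "(0, 0, None, {}, {}, {}, {}) \<in> bfs_states n X" for X by (simp add: bfs_states_def)
  show "bfs_upd X v N s \<in> bfs_states n X" if "v < n" "N \<subseteq> X" "s \<in> bfs_states n X" for X v N s
    using that by (rule bfs_upd_closed)
  show "bfs_endp X s \<in> bfs_states n X" if "s \<in> bfs_states n X" for X s
    using that by (rule bfs_endp_closed)
  show "finite (bfs_states n X) \<and> card (bfs_states n X) \<le> n * 2 ^ (7 * k + 5)"
    if "X \<subseteq> {..<n}" "card X = k" for X
    using that n finite_subset[of X "{..<n}"] by (intro card_bfs_states) auto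
  have log: "log 2 (real n) \<ge> 0" using n by (simp add: zero_le_log_cancel_iff)
  have "1 + n * 2 ^ k \<le> n * 2 ^ Suc k" using n by (simp add: Suc_le_eq)
  then have "n ^ k * ((1 + n * 2 ^ k) * (n * 2 ^ (7 * k + 5))) \<le>
      n ^ k * ((n * 2 ^ Suc k) * (n * 2 ^ (7 * k + 5)))"
    by (intro mult_le_mono2 mult_le_mono1)
  also have "\<dots> = n ^ (k + 2) * 2 ^ (Suc k + (7 * k + 5))"
    unfolding power_add power2_eq_square by (simp only: mult_ac)
  \<comment> \<open>Since \<open>n \<ge> 2\<close>, powers of \<open>2\<close> become powers of
    \<open>n\<close>; the total exponent \<open>9 * k + 8\<close> is at most \<open>17 * k\<close>
    as \<open>k \<ge> 1\<close>.\<close>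
  also have "\<dots> \<le> n ^ (k + 2) * n ^ (Suc k + (7 * k + 5))"
    using n by (intro mult_le_mono2 power_mono) auto
  also have "\<dots> = n ^ (k + 2 + (Suc k + (7 * k + 5)))" by (simp only: power_add)
  also have "\<dots> \<le> n ^ (17 * k)" using n k by (intro power_increasing) auto
  finally have "real (n ^ k * ((1 + n * 2 ^ k) * (n * 2 ^ (7 * k + 5)))) \<le> real (n ^ (17 * k) * 2 ^ 0)"
    unfolding power_0 mult_1_right by (simp only: of_nat_le_iff)
  also have "\<dots> = 2 powr (real (17 * k) * log 2 (real n) + real 0)"
    using n by (intro power_mult_eq_two_powr) simp
  also have "\<dots> = 2 powr (17 * real k * log 2 (real n))" by simp
  finally show "n ^ k * ((1 + n * 2 ^ k) * (n * 2 ^ (7 * k + 5))) \<le> 2 ^ nat \<lceil>17 * real k * log 2 (real n)\<rceil>"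
    using log by (intro le_two_power_ceiling) auto
  show "(case (run_pass bfs_upd bfs_endp E X vs ^^ ((2 ^ k + k) * (2 * k + 2))) (0, 0, None, {}, {}, {}, {})
      of (j, m, src, A, B, C, W) \<Rightarrow> INF m\<in>{1..2 * card X + 1} - W. enat (m - 1)) = diameter {..<n} E"
    if "simple_graph {..<n} E" "vertex_cover {..<n} E X" "card X = k" "set vs = {..<n}" for E X vs
  proof -
    interpret covered_graph n E X vs using that by unfold_locales
    have "{1..2 * card X + 1} - {1..2 * card X + 1} \<inter> T = {1..2 * card X + 1} - T" for T by auto
    then show ?thesis
      using bfs_sources[OF order_refl] far_sources diameter_eq_INF n that(3) by simp
  qed
qed

section \<open>Uniform constants and the four bounds\<close>

lemma multi_pass_diameter:
  assumes "n \<ge> 1"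
  shows "\<exists>A p b. solves A diameter p b n k \<and> real p \<le> 18 * (2 ^ k * real k) \<and>
    real b \<le> 18 * (real k * log 2 (real n))"
proof (cases "n = 1 \<or> k = 0")
  case True
  have "log 2 (real n) \<ge> 0" using assms by (simp add: zero_le_log_cancel_iff)
  moreover obtain A where "solves A diameter 0 0 n k" using solves_edgeless[OF True] by blast
  ultimately show ?thesis by (intro exI[of _ A] exI[of _ 0]) auto
next
  case False
  then have nk: "n \<ge> 2" "k \<ge> 1" using assms by auto
  then obtain A where "solves A diameter ((2 ^ k + k) * (2 * k + 2))
      (nat \<lceil>17 * real k * log 2 (real n)\<rceil>) n k" using multi_pass_diameter_nontrivial by blast
  moreover have "real ((2 ^ k + k) * (2 * k + 2)) \<le> 18 * (2 ^ k * real k)"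
  proof -
    have "(2 ^ k + k) * (2 * k + 2) \<le> (2 * 2 ^ k) * (4 * k)"
      using Suc_le_two_power[of k] nk by (intro mult_le_mono) auto
    also have "\<dots> \<le> 18 * (2 ^ k * k)" by simp
    finally have "real ((2 ^ k + k) * (2 * k + 2)) \<le> real (18 * (2 ^ k * k))" by (simp only: of_nat_le_iff)
    then show ?thesis by simp
  qed
  moreover have "real (nat \<lceil>17 * real k * log 2 (real n)\<rceil>) \<le> 18 * (real k * log 2 (real n))"
  proof -
    have log: "log 2 (real n) \<ge> 1" using nk by (simp add: le_log_iff)
    \<comment> \<open>The unit lost by rounding up is absorbed by \<open>k * log n \<ge> 1\<close>,
      which turns \<open>17\<close> into \<open>18\<close>.\<close>
    then have "1 * 1 \<le> real k * log 2 (real n)" using nk by (intro mult_mono) auto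
    moreover have "real (nat \<lceil>17 * real k * log 2 (real n)\<rceil>) \<le> 17 * real k * log 2 (real n) + 1"
      using log by (simp add: of_nat_ceiling)
    ultimately show ?thesis by linarith
  qed
  ultimately show ?thesis by blast
qed

lemma one_pass_diameter:
  assumes "n \<ge> 1"
  shows "\<exists>A b. solves A diameter 1 b n k \<and> real b \<le> 6 * (2 ^ k + real k * log 2 (real n))"
proof -
  have log: "log 2 (real n) \<ge> 0" using assms by (simp add: zero_le_log_cancel_iff)
  show ?thesis
  proof (cases "n = 1 \<or> k = 0")
    case True
    then obtain A where "solves A diameter 1 0 n k" using solves_edgeless by blast
    with log show ?thesis by (intro exI[of _ A] exI[of _ 0]) auto
  next
    case False
    then have nk: "n \<ge> 2" "k \<ge> 1" using assms by auto
    then obtain A where "solves A diameter 1 (nat \<lceil>2 * real k * log 2 (real n) + 5 * 2 ^ k\<rceil>) n k"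
      using one_pass_diameter_nontrivial by blast
    moreover have "real (nat \<lceil>2 * real k * log 2 (real n) + 5 * 2 ^ k\<rceil>) \<le>
        6 * (2 ^ k + real k * log 2 (real n))"
    proof -
      have "real (nat \<lceil>2 * real k * log 2 (real n) + 5 * 2 ^ k\<rceil>) \<le>
          2 * (real k * log 2 (real n)) + 5 * 2 ^ k + 1"
        using log by (simp add: of_nat_ceiling mult.assoc)
      \<comment> \<open>Here rounding is absorbed by \<open>2 ^ k\<close>, which turns
        \<open>5\<close> into \<open>6\<close>.\<close>
      moreover have "(1 :: real) \<le> 2 ^ k" by simp
      moreover have "0 \<le> real k * log 2 (real n)" using log by simp
      ultimately show ?thesis unfolding distrib_left by linarith
    qed
    ultimately show ?thesis by blast
  qed
qed

lemma multi_pass_solvableI: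
  assumes "\<And>n k. n \<ge> 1 \<Longrightarrow> \<exists>A p b. solves A P p b n k \<and> real p \<le> C * f n k \<and> real b \<le> C * g n k"
  shows "multi_pass_solvable P f g"
proof -
  have "\<forall>n k. \<exists>A p b. n \<ge> 1 \<longrightarrow> solves A P p b n k \<and> real p \<le> C * f n k \<and> real b \<le> C * g n k"
    using assms by blast
  then show ?thesis unfolding multi_pass_solvable_def by metis
qed

lemma one_pass_solvableI:
  assumes "\<And>n k. n \<ge> 1 \<Longrightarrow> \<exists>A b. solves A P 1 b n k \<and> real b \<le> C * g n k"
  shows "one_pass_solvable P g"
proof -
  have "\<forall>n k. \<exists>A b. n \<ge> 1 \<longrightarrow> solves A P 1 b n k \<and> real b \<le> C * g n k"
    using assms by blast
  then show ?thesis unfolding one_pass_solvable_def by metis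
qed

theorem theorem1:
  shows "multi_pass_solvable diameter (\<lambda>n k. 2 ^ k * real k) (\<lambda>n k. real k * log 2 (real n)) \<and>
    multi_pass_solvable connected_graph (\<lambda>n k. 2 ^ k * real k) (\<lambda>n k. real k * log 2 (real n)) \<and>
    one_pass_solvable diameter (\<lambda>n k. 2 ^ k + real k * log 2 (real n)) \<and>
    one_pass_solvable connected_graph (\<lambda>n k. 2 ^ k + real k * log 2 (real n))"
proof (intro conjI)
  show "multi_pass_solvable diameter (\<lambda>n k. 2 ^ k * real k) (\<lambda>n k. real k * log 2 (real n))"
    by (rule multi_pass_solvableI[OF multi_pass_diameter])
  show "multi_pass_solvable connected_graph (\<lambda>n k. 2 ^ k * real k) (\<lambda>n k. real k * log 2 (real n))"
    using multi_pass_diameter solves_connected_if_diameter by (intro multi_pass_solvableI[where C = 18]) meson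
  show "one_pass_solvable diameter (\<lambda>n k. 2 ^ k + real k * log 2 (real n))"
    by (rule one_pass_solvableI[OF one_pass_diameter])
  show "one_pass_solvable connected_graph (\<lambda>n k. 2 ^ k + real k * log 2 (real n))"
    using one_pass_diameter solves_connected_if_diameter by (intro one_pass_solvableI[where C = 6]) meson
qed

end
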